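(* Let $d \ge 2$ be an integer. For an integer $H \ge 1$, let $E_d(H)$ denote the number of monic polynomials $f(X) = X^d + a_{d-1}X^{d-1} + \dots + a_1X + a_0 \in \mathbb{Z}[X]$ with $\max\{|a_0|,\ldots,|a_{d-1}|\} \le H$ which are Eisenstein polynomials. Then, as $H \to \infty$, $$ E_d(H)=\vartheta_d 2^d H^d+\begin{cases} O\left(H^{d-1}\right),& \text{if } d>2, \\ O\left(H(\log H)^2\right),& \text{if } d=2, \end{cases} $$ where $$ \vartheta_d = 1-\prod_{p \text{ prime}}\left(1- \frac{p-1}{p^{d+1}}\right), $$ and the implied constants may depend on $d$.
   Context: A polynomial $f(X) = a_dX^d + a_{d-1}X^{d-1} + \dots + a_1X + a_0 \in \mathbb{Z}[X]$ is called an Eisenstein polynomial if there exists a prime $p$ such that (i) $p \mid a_i$ for $i = 0,\ldots,d-1$, (ii) $p^2 \nmid a_0$, and (iii) $p \nmid a_d$. The notation $U = O(V)$ means $|U| \le c|V|$ for some constant $c>0$. *)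

theory Defs
  imports
    "HOL-Analysis.Analysis"
    "HOL-Computational_Algebra.Polynomial"
    "HOL-Computational_Algebra.Primes"
    "HOL-Library.Landau_Symbols"
begin

definition eisenstein_poly :: "int poly \<Rightarrow> bool" where
  "eisenstein_poly f \<longleftrightarrow>
     (\<exists>p::int. prime p \<and>
        (\<forall>i<degree f. p dvd coeff f i) \<and>
        \<not> p\<^sup>2 dvd coeff f 0 \<and>
        \<not> p dvd lead_coeff f)"

definition monic_eisenstein_polys :: "nat \<Rightarrow> nat \<Rightarrow> int poly set" where
  "monic_eisenstein_polys d H =
     {f. degree f = d \<and> lead_coeff f = 1 \<and>
         (\<forall>i<d. \<bar>coeff f i\<bar> \<le> int H) \<and> eisenstein_poly f}"

definition monic_eisenstein_count :: "nat \<Rightarrow> nat \<Rightarrow> nat" where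
  "monic_eisenstein_count d H = card (monic_eisenstein_polys d H)"

(* The product over the primes is written as a product over all natural numbers
   whose factors at non-primes are 1; convergent_prod_eisenstein_density below
   shows that it converges for d \<ge> 2. *)
definition eisenstein_density :: "nat \<Rightarrow> real" where
  "eisenstein_density d =
     1 - (\<Prod>p::nat. if prime p then 1 - (real p - 1) / real p ^ (d + 1) else 1)"

(* Finiteness, so that card in monic_eisenstein_count is the actual number of elements. *)
lemma finite_monic_eisenstein_polys: "finite (monic_eisenstein_polys d H)"
proof (rule inj_on_finite)
  let ?g = "\<lambda>f. map (coeff f) [0..<d]"
  show "finite {xs. set xs \<subseteq> {- int H..int H} \<and> length xs = d}"
    by (rule finite_lists_length_eq) simp
  show "?g ` monic_eisenstein_polys d H \<subseteq> {xs. set xs \<subseteq> {- int H..int H} \<and> length xs = d}"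
    unfolding monic_eisenstein_polys_def by (auto simp: abs_le_iff minus_le_iff)
  show "inj_on ?g (monic_eisenstein_polys d H)"
  proof (rule inj_onI)
    fix f g assume f: "f \<in> monic_eisenstein_polys d H" and g: "g \<in> monic_eisenstein_polys d H"
      and eq: "?g f = ?g g"
    have "coeff f i = coeff g i" for i
    proof (cases i d rule: linorder_cases)
      case less
      thus ?thesis using eq by simp
    next
      case equal
      thus ?thesis using f g unfolding monic_eisenstein_polys_def by auto
    next
      case greater
      thus ?thesis using f g unfolding monic_eisenstein_polys_def by (simp add: coeff_eq_0)
    qed
    thus "f = g" by (simp add: poly_eq_iff)
  qed
qed

lemma convergent_prod_eisenstein_density:
  assumes "d \<ge> 2"
  shows "convergent_prod
    (\<lambda>p::nat. if prime p then 1 - (real p - 1) / real p ^ (d + 1) else 1)"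
    (is "convergent_prod ?f")
proof -
  have bound: "norm (norm (?f p - 1)) \<le> 1 / real p ^ 2" for p
  proof (cases "prime p")
    case True
    hence p: "real p \<ge> 1"
      using prime_ge_1_nat by simp
    have "(real p - 1) / real p ^ (d + 1) \<le> real p / real p ^ (d + 1)"
      using p by (intro divide_right_mono) auto
    also have "\<dots> = 1 / real p ^ d"
      using p by simp
    also have "\<dots> \<le> 1 / real p ^ 2"
      using p assms by (intro divide_left_mono power_increasing) auto
    finally show ?thesis
      using p True by simp
  qed simp
  have "summable (\<lambda>p. 1 / real p ^ 2)"
    using inverse_power_summable[of 2, where 'a = real] by (simp add: field_simps)
  hence "summable (\<lambda>p. norm (?f p - 1))"
    by (rule summable_comparison_test') (rule bound)
  hence "abs_convergent_prod ?f"
    by (rule summable_imp_abs_convergent_prod)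
  thus ?thesis
    by (rule abs_convergent_prod_imp_convergent_prod)
qed

end

theory Submission
  imports Defs
begin

text \<open>
  By inclusion-exclusion over the finite sets \<open>S\<close> of primes up to \<open>H\<close>, the number of monic
  polynomials of height at most \<open>H\<close> that are not Eisenstein is the alternating sum of the numbers
  of those that are Eisenstein at every \<open>p \<in> S\<close>. With \<open>s = \<Prod>S\<close>, such a number is the count for the
  constant coefficient times the \<open>(d - 1)\<close>-st power of the number of multiples of \<open>s\<close> in
  \<open>[-H, H]\<close>. If \<open>s \<le> H\<close> it equals \<open>(2H)\<^sup>d (\<Prod>p\<in>S. (p - 1) / p\<^bsup>d+1\<^esup>)\<close> up to an error of order
  \<open>2\<^bsup>card S\<^esup> (H/s)\<^bsup>d-1\<^esup>\<close>; if \<open>s > H\<close> it vanishes, because the constant coefficient of an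
  Eisenstein polynomial is nonzero. The main terms add up to the finite Euler product over
  \<open>p \<le> H\<close>, and the contribution of \<open>s > H\<close> and the tail of the infinite product are both
  \<open>O(1/H\<^bsup>d-1\<^esup>)\<close> relative to \<open>H\<^sup>d\<close>. Since \<open>2\<^bsup>card S\<^esup>\<close> counts the factorisations \<open>s = a b\<close>,
  the errors sum to at most a constant times
  \<open>H\<^bsup>d-1\<^esup> (\<Sum>n\<le>H. 1/n\<^bsup>d-1\<^esup>)\<^sup>2\<close>; the inner sum is bounded for \<open>d > 2\<close> and
  \<open>O(log H)\<close> for \<open>d = 2\<close>.
\<close>

subsection \<open>Power sums and multiples in an interval\<close>

text \<open>For \<open>e = 2\<close> the sum telescopes through 1/(k+1)^2 \<le> 1/k - 1/(k+1), and a
  larger exponent contributes the factor 1/n^(e-2). The bound serves the sets of primes with large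
  product, the tail of the Euler product and, for d > 2, the error sum.\<close>

lemma sum_inverse_power_tail:
  fixes n m e :: nat
  assumes "n \<ge> 1" "e \<ge> 2"
  shows "(\<Sum>k\<in>{n<..m}. 1 / real k ^ e) \<le> 1 / real n ^ (e - 1)"
proof (cases "n \<le> m")
  case True
  have telescope: "(\<Sum>k\<in>{n<..m}. 1 / real k ^ 2) \<le> 1 / real n - 1 / real m"
    using True
  proof (induction rule: dec_induct)
    case (step m)
    have m: "real m > 0" using step assms by simp
    have "{n<..Suc m} = insert (Suc m) {n<..m}" using step by auto
    moreover have "1 / real (Suc m) ^ 2 \<le> 1 / real m - 1 / real (Suc m)"
    proof -
      have "1 / real (Suc m) ^ 2 \<le> 1 / (real m * real (Suc m))"
        using m by (intro divide_left_mono) (auto simp: power2_eq_square)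
      also have "\<dots> = 1 / real m - 1 / real (Suc m)"
        using m by (simp add: field_simps)
      finally show ?thesis .
    qed
    ultimately show ?case using step.IH by simp
  qed simp
  have "(\<Sum>k\<in>{n<..m}. 1 / real k ^ e) \<le> (\<Sum>k\<in>{n<..m}. 1 / real n ^ (e - 2) * (1 / real k ^ 2))"
  proof (rule sum_mono)
    fix k assume k: "k \<in> {n<..m}"
    have "real k ^ e = real k ^ (e - 2) * real k ^ 2"
      using assms by (metis le_add_diff_inverse2 power_add)
    moreover have "real n ^ (e - 2) \<le> real k ^ (e - 2)"
      using k by (intro power_mono) auto
    ultimately show "1 / real k ^ e \<le> 1 / real n ^ (e - 2) * (1 / real k ^ 2)"
      using k assms by (simp add: frac_le mult_right_mono)
  qed
  also have "\<dots> = 1 / real n ^ (e - 2) * (\<Sum>k\<in>{n<..m}. 1 / real k ^ 2)"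
    by (simp add: sum_distrib_left)
  also have "\<dots> \<le> 1 / real n ^ (e - 2) * (1 / real n)"
    using telescope by (intro mult_left_mono order.trans[OF telescope]) auto
  also have "\<dots> = 1 / real n ^ (e - 1)"
  proof -
    have "e - 1 = Suc (e - 2)" using assms by simp
    thus ?thesis by simp
  qed
  finally show ?thesis .
qed simp

lemma harmonic_sum_le:
  assumes "n \<ge> 1"
  shows "(\<Sum>k=1..n. 1 / real k) \<le> 1 + ln (real n)"
  using assms
proof (induction rule: dec_induct)
  case (step n)
  have n: "real n > 0" using step by simp
  have "ln (real n / real (Suc n)) \<le> real n / real (Suc n) - 1"
    using n by (intro ln_le_minus_one) simp
  hence "1 / real (Suc n) \<le> ln (real (Suc n)) - ln (real n)"
    using n by (simp add: ln_div field_simps)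
  thus ?case using step.IH by simp
qed simp

text \<open>The general family \<open>g\<close> covers both the primes themselves and a mixture of
  primes and prime squares.\<close>

lemma prod_dvd_iff_coprime:
  fixes g :: "'b \<Rightarrow> 'a::semiring_gcd"
  assumes "finite S" "\<And>p q. p \<in> S \<Longrightarrow> q \<in> S \<Longrightarrow> p \<noteq> q \<Longrightarrow> coprime (g p) (g q)"
  shows "prod g S dvd a \<longleftrightarrow> (\<forall>p\<in>S. g p dvd a)"
  using assms
proof (induction S rule: finite_induct)
  case (insert p S)
  have "coprime (g p) (prod g S)"
    using insert.hyps insert.prems by (intro prod_coprime_right) auto
  hence "g p * prod g S dvd a \<longleftrightarrow> g p dvd a \<and> prod g S dvd a"
    by (meson divides_mult dvd_mult_left dvd_mult_right)
  thus ?case using insert by simp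
qed simp

lemma card_multiples_symmetric_interval:
  fixes H m :: nat
  assumes "m \<ge> 1"
  shows "card {a::int. \<bar>a\<bar> \<le> int H \<and> int m dvd a} = 2 * (H div m) + 1"
proof -
  define q where "q = int (H div m)"
  have "{a::int. \<bar>a\<bar> \<le> int H \<and> int m dvd a} = (\<lambda>b. int m * b) ` {-q..q}"
  proof (intro equalityI subsetI)
    fix a assume "a \<in> {a::int. \<bar>a\<bar> \<le> int H \<and> int m dvd a}"
    then obtain b where b: "a = int m * b" "\<bar>int m * b\<bar> \<le> int H" by auto
    hence "\<bar>b\<bar> * int m \<le> int H" by (simp add: abs_mult mult.commute)
    hence "\<bar>b\<bar> \<le> int H div int m"
      using assms zdiv_mono1[of "\<bar>b\<bar> * int m" "int H" "int m"] by simp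
    hence "\<bar>b\<bar> \<le> q" by (simp add: q_def zdiv_int)
    thus "a \<in> (\<lambda>b. int m * b) ` {-q..q}" unfolding b by (intro imageI) (simp add: abs_le_iff)
  next
    fix a assume "a \<in> (\<lambda>b. int m * b) ` {-q..q}"
    then obtain b where "a = int m * b" "b \<in> {-q..q}" by blast
    hence b: "a = int m * b" "\<bar>b\<bar> \<le> q" by (auto simp: abs_le_iff)
    have "\<bar>a\<bar> = int m * \<bar>b\<bar>" by (simp add: b abs_mult)
    also have "\<dots> \<le> int m * q" using b by (intro mult_left_mono) auto
    also have "\<dots> \<le> int H" unfolding q_def
      by (metis of_nat_le_iff of_nat_mult times_div_less_eq_dividend)
    finally show "a \<in> {a::int. \<bar>a\<bar> \<le> int H \<and> int m dvd a}" using b by auto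
  qed
  moreover have "inj_on (\<lambda>b. int m * b) {-q..q}"
    using assms by (auto simp: inj_on_def)
  ultimately have "card {a::int. \<bar>a\<bar> \<le> int H \<and> int m dvd a} = card {-q..q}"
    by (simp add: card_image)
  thus ?thesis by (simp add: q_def)
qed

text \<open>With x = H/m the count is 2 * floor x + 1. Rounding shifts 2x by an amount between -2
  and 0, and the multiple 0 recentres this error to at most 1 in absolute value.\<close>

lemma card_multiples_symmetric_interval_approx:
  fixes H m :: nat
  assumes "m \<ge> 1"
  shows "\<bar>real (card {a::int. \<bar>a\<bar> \<le> int H \<and> int m dvd a}) - 2 * real H / real m\<bar> \<le> 1"
proof -
  have "real (H div m) = of_int \<lfloor>real H / real m\<rfloor>"
    by (simp add: floor_divide_of_nat_eq)
  moreover have "of_int \<lfloor>real H / real m\<rfloor> \<le> real H / real m"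
    "real H / real m < of_int \<lfloor>real H / real m\<rfloor> + 1"
    by linarith+
  moreover have "2 * real H / real m = 2 * (real H / real m)" by simp
  ultimately show ?thesis
    unfolding card_multiples_symmetric_interval[OF assms] by simp linarith
qed

text \<open>Inclusion-exclusion, obtained by expanding the product of the factors 1 -
  \<open>of_bool (A p x)\<close> and exchanging the sums over \<open>x\<close> and over
  subsets.\<close>

lemma card_avoiding_conv_sum:
  assumes "finite X" "finite P"
  shows "real (card {x\<in>X. \<forall>p\<in>P. \<not> A p x}) =
    (\<Sum>S\<in>Pow P. (-1) ^ card S * real (card {x\<in>X. \<forall>p\<in>S. A p x}))"
proof -
  have card_eq: "real (card {x\<in>X. \<forall>p\<in>S. B p x}) = (\<Sum>x\<in>X. \<Prod>p\<in>S. of_bool (B p x))"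
    if "S \<subseteq> P" for S B
  proof -
    have S: "finite S" using that assms finite_subset by blast
    have "(\<Prod>p\<in>S. of_bool (B p x) :: real) = of_bool (\<forall>p\<in>S. B p x)" for x
      using S by (induction S rule: finite_induct) auto
    thus ?thesis using assms by (simp add: Int_def)
  qed
  have "real (card {x\<in>X. \<forall>p\<in>P. \<not> A p x}) = (\<Sum>x\<in>X. \<Prod>p\<in>P. 1 - of_bool (A p x))"
    by (subst card_eq) (simp_all add: of_bool_not_iff)
  also have "\<dots> = (\<Sum>x\<in>X. \<Sum>S\<in>Pow P. (-1) ^ card S * (\<Prod>p\<in>S. of_bool (A p x)))"
    using assms by (simp add: prod_diff_conv_sum)
  also have "\<dots> = (\<Sum>S\<in>Pow P. \<Sum>x\<in>X. (-1) ^ card S * (\<Prod>p\<in>S. of_bool (A p x)))"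
    by (rule sum.swap)
  also have "\<dots> = (\<Sum>S\<in>Pow P. (-1) ^ card S * real (card {x\<in>X. \<forall>p\<in>S. A p x}))"
    by (intro sum.cong refl) (simp add: card_eq sum_distrib_left)
  finally show ?thesis .
qed

subsection \<open>Products of finite sets of primes\<close>

lemma prime_dvd_Prod_iff:
  fixes S :: "nat set"
  assumes "finite S" "\<And>q. q \<in> S \<Longrightarrow> prime q" "prime p"
  shows "p dvd \<Prod>S \<longleftrightarrow> p \<in> S"
  using assms by (metis prime_dvd_prod_iff primes_dvd_imp_eq dvd_refl)

lemma Prod_primes_ge_1:
  fixes S :: "nat set"
  assumes "\<And>q. q \<in> S \<Longrightarrow> prime q"
  shows "\<Prod>S \<ge> 1"
  using assms by (intro prod_ge_1) (auto simp: Suc_le_eq prime_gt_0_nat)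

text \<open>The primes dividing such a product are exactly the elements of the set. This turns sums
  over sets of primes into sums over distinct integers.\<close>

lemma inj_on_Prod_primes:
  "inj_on (\<lambda>S. \<Prod>S) {S :: nat set. finite S \<and> (\<forall>p\<in>S. prime p)}"
proof (rule inj_onI)
  fix S T :: "nat set"
  assume S: "S \<in> {S. finite S \<and> (\<forall>p\<in>S. prime p)}" and T: "T \<in> {S. finite S \<and> (\<forall>p\<in>S. prime p)}"
    and eq: "\<Prod>S = \<Prod>T"
  have "p \<in> S \<longleftrightarrow> p \<in> T" for p
    using S T eq prime_dvd_Prod_iff[of S p] prime_dvd_Prod_iff[of T p] by (cases "prime p") auto
  thus "S = T" by blast
qed

text \<open>The factor 2^card S counts the subsets T of S, and (S, T) is sent to the pair of
  products over T and over S - T. Both entries lie in {1..H}, so summing over all such pairs only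
  increases the value and yields a square.\<close>

lemma sum_subsets_two_power_le:
  fixes P :: "nat set" and H k :: nat
  assumes "finite P" "\<And>p. p \<in> P \<Longrightarrow> prime p"
  shows "(\<Sum>S\<in>{S. S \<subseteq> P \<and> \<Prod>S \<le> H}. 2 ^ card S / real (\<Prod>S) ^ k)
    \<le> (\<Sum>n=1..H. 1 / real n ^ k)\<^sup>2"
proof -
  let ?D = "{S. S \<subseteq> P \<and> \<Prod>S \<le> H}"
  let ?h = "\<lambda>(S, T). (\<Prod>T, \<Prod>(S - T) :: nat)"
  let ?g = "\<lambda>(a, b). 1 / real a ^ k * (1 / real b ^ k)"
  have fin: "finite S" if "S \<subseteq> P" for S
    using that assms finite_subset by blast
  have prm: "prime p" if "p \<in> S" "S \<subseteq> P" for p S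
    using that assms by blast
  have finD: "finite ?D" using assms by simp
  have "(\<Sum>S\<in>?D. 2 ^ card S / real (\<Prod>S) ^ k) = (\<Sum>S\<in>?D. \<Sum>T\<in>Pow S. ?g (?h (S, T)))"
  proof (rule sum.cong)
    fix S assume S: "S \<in> ?D"
    hence finS: "finite S" using fin by blast
    have "?g (?h (S, T)) = 1 / real (\<Prod>S) ^ k" if "T \<in> Pow S" for T
    proof -
      have "\<Prod>S = \<Prod>(S - T) * \<Prod>T"
        using that finS by (intro prod.subset_diff) auto
      hence "real (\<Prod>S) = real (\<Prod>(S - T)) * real (\<Prod>T)"
        by (metis of_nat_mult)
      thus ?thesis by (simp add: power_mult_distrib)
    qed
    hence "(\<Sum>T\<in>Pow S. ?g (?h (S, T))) = (\<Sum>T\<in>Pow S. 1 / real (\<Prod>S) ^ k)"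
      by (intro sum.cong refl)
    thus "2 ^ card S / real (\<Prod>S) ^ k = (\<Sum>T\<in>Pow S. ?g (?h (S, T)))"
      using finS by (simp add: card_Pow del: of_nat_prod)
  qed simp
  also have "\<dots> = (\<Sum>x\<in>Sigma ?D Pow. ?g (?h x))"
  proof (subst sum.Sigma)
    show "\<forall>S\<in>?D. finite (Pow S)" using fin by blast
  qed (use finD in \<open>auto simp: case_prod_beta\<close>)
  \<comment> \<open>\<open>?h\<close> is injective since a set of primes is determined by its product\<close>
  also have "\<dots> = (\<Sum>y\<in>?h ` Sigma ?D Pow. ?g y)"
  proof (subst sum.reindex)
    show "inj_on ?h (Sigma ?D Pow)"
    proof (rule inj_onI)
      fix x y assume x: "x \<in> Sigma ?D Pow" and y: "y \<in> Sigma ?D Pow" and eq: "?h x = ?h y"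
      obtain S T where xST: "x = (S, T)" by fastforce
      obtain S' T' where yST: "y = (S', T')" by fastforce
      have sub: "T \<subseteq> S" "S \<subseteq> P" "T' \<subseteq> S'" "S' \<subseteq> P" using x y xST yST by auto
      have "T = T'"
        using eq sub xST yST fin prm by (intro inj_onD[OF inj_on_Prod_primes]) auto
      moreover have "S - T = S' - T'"
        using eq sub xST yST by (intro inj_onD[OF inj_on_Prod_primes]) (auto intro: fin prm)
      ultimately show "x = y" using sub xST yST by auto
    qed
  qed simp
  also have "\<dots> \<le> (\<Sum>y\<in>{1..H} \<times> {1..H}. ?g y)"
  proof (rule sum_mono2)
    show "?h ` Sigma ?D Pow \<subseteq> {1..H} \<times> {1..H}"
    proof clarify
      fix S T assume S: "S \<subseteq> P" "\<Prod>S \<le> H" and T: "T \<subseteq> S"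
      have "\<Prod>S = \<Prod>(S - T) * \<Prod>T"
        using S T fin by (intro prod.subset_diff) auto
      moreover have "\<Prod>T \<ge> 1" "\<Prod>(S - T) \<ge> 1"
        using S T prm by (intro Prod_primes_ge_1; blast)+
      ultimately have "\<Prod>T \<le> \<Prod>S" "\<Prod>(S - T) \<le> \<Prod>S" by auto
      thus "\<Prod>T \<in> {1..H} \<and> \<Prod>(S - T) \<in> {1..H}"
        using S \<open>\<Prod>T \<ge> 1\<close> \<open>\<Prod>(S - T) \<ge> 1\<close> by auto
    qed
  qed auto
  also have "\<dots> = (\<Sum>n=1..H. 1 / real n ^ k)\<^sup>2"
    unfolding power2_eq_square sum_product sum.cartesian_product by simp
  finally show ?thesis .
qed

section \<open>Multiples of a squarefree number that avoid the squares of its primes\<close>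

lemma prod_int_primes_dvd_iff:
  fixes S :: "nat set"
  assumes "finite S" "\<And>p. p \<in> S \<Longrightarrow> prime p"
  shows "prod int S dvd a \<longleftrightarrow> (\<forall>p\<in>S. int p dvd a)"
proof -
  have "coprime (int p) (int q)" if "p \<in> S" "q \<in> S" "p \<noteq> q" for p q
    using that assms primes_coprime[of p q] by simp
  thus ?thesis using prod_dvd_iff_coprime[of S int a] assms(1) by simp
qed

text \<open>The squares are removed by inclusion-exclusion over T \<subseteq> S. Each of the 2^card
  S terms counts the multiples of one integer with error at most 1, and the main terms recombine
  into the product of 1 - 1/p.\<close>

lemma card_multiples_not_square_approx:
  fixes S :: "nat set" and H :: nat
  assumes S: "finite S" "\<And>p. p \<in> S \<Longrightarrow> prime p"
  shows "\<bar>real (card {a::int. \<bar>a\<bar> \<le> int H \<and> int (\<Prod>S) dvd a \<and> (\<forall>p\<in>S. \<not> (int p)\<^sup>2 dvd a)})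
      - 2 * real H / real (\<Prod>S) * (\<Prod>p\<in>S. 1 - 1 / real p)\<bar> \<le> 2 ^ card S"
proof -
  let ?X = "{a::int. \<bar>a\<bar> \<le> int H \<and> int (\<Prod>S) dvd a}"
  let ?c = "\<lambda>T. card {a\<in>?X. \<forall>p\<in>T. (int p)\<^sup>2 dvd a}"
  have fin: "finite ?X"
    by (rule finite_subset[of _ "{-int H..int H}"]) (auto simp: abs_le_iff)
  have eq1: "real (card {a::int. \<bar>a\<bar> \<le> int H \<and> int (\<Prod>S) dvd a \<and> (\<forall>p\<in>S. \<not> (int p)\<^sup>2 dvd a)})
      = (\<Sum>T\<in>Pow S. (-1) ^ card T * real (?c T))"
    unfolding card_avoiding_conv_sum[OF fin S(1), symmetric]
    by (intro arg_cong[where f = real] arg_cong[where f = card]) auto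
  have "2 * real H / real (\<Prod>S) * (\<Prod>p\<in>S. 1 - 1 / real p)
      = 2 * real H / real (\<Prod>S) * (\<Sum>T\<in>Pow S. (-1) ^ card T * (\<Prod>p\<in>T. 1 / real p))"
    using S by (subst prod_diff_conv_sum) auto
  also have "\<dots> = (\<Sum>T\<in>Pow S. (-1) ^ card T * (2 * real H / real (\<Prod>S * \<Prod>T)))"
    unfolding sum_distrib_left
    by (intro sum.cong refl) (simp add: prod_dividef)
  finally have eq2: "2 * real H / real (\<Prod>S) * (\<Prod>p\<in>S. 1 - 1 / real p)
      = (\<Sum>T\<in>Pow S. (-1) ^ card T * (2 * real H / real (\<Prod>S * \<Prod>T)))" .
  have bound: "\<bar>real (?c T) - 2 * real H / real (\<Prod>S * \<Prod>T)\<bar> \<le> 1" if T: "T \<subseteq> S" for T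
  proof -
    define g where "g = (\<lambda>p. if p \<in> T then (int p)\<^sup>2 else int p)"
    have finT: "finite T" using T S finite_subset by blast
    have cop: "coprime (g p) (g q)" if "p \<in> S" "q \<in> S" "p \<noteq> q" for p q
      using that S primes_coprime[of p q] by (auto simp: g_def)
    \<comment> \<open>divisibility of a multiple of \<open>\<Prod>S\<close> by all \<open>p\<^sup>2\<close> with \<open>p \<in> T\<close> is divisibility by \<open>\<Prod>S * \<Prod>T\<close>\<close>
    have "prod g S = int (\<Prod>S * \<Prod>T)"
    proof -
      have "prod g S = prod g (S - T) * prod g T"
        using T S by (intro prod.subset_diff) auto
      also have "\<dots> = int (\<Prod>(S - T)) * (int (\<Prod>T))\<^sup>2"
        by (simp add: g_def prod_power_distrib)
      also have "\<dots> = int (\<Prod>(S - T) * \<Prod>T * \<Prod>T)"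
        by (simp add: power2_eq_square)
      also have "\<Prod>(S - T) * \<Prod>T = \<Prod>S"
        using T S by (intro prod.subset_diff[symmetric]) auto
      finally show ?thesis .
    qed
    hence "int (\<Prod>S * \<Prod>T) dvd a \<longleftrightarrow> (\<forall>p\<in>S. g p dvd a)" for a
      using prod_dvd_iff_coprime[of S g a, OF S(1) cop] by simp
    moreover have "int p dvd a" if "(int p)\<^sup>2 dvd a" for p a
      using that by (metis dvd_mult_left power2_eq_square)
    ultimately have "{a\<in>?X. \<forall>p\<in>T. (int p)\<^sup>2 dvd a} = {a. \<bar>a\<bar> \<le> int H \<and> int (\<Prod>S * \<Prod>T) dvd a}"
      using T by (auto simp: g_def prod_int_primes_dvd_iff S split: if_splits)
    moreover have "\<Prod>S * \<Prod>T \<ge> 1"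
      using mult_le_mono[OF Prod_primes_ge_1[of S] Prod_primes_ge_1[of T]] S T by auto
    ultimately show ?thesis
      using card_multiples_symmetric_interval_approx[of "\<Prod>S * \<Prod>T" H] by simp
  qed
  have "\<bar>(\<Sum>T\<in>Pow S. (-1) ^ card T * real (?c T))
      - (\<Sum>T\<in>Pow S. (-1) ^ card T * (2 * real H / real (\<Prod>S * \<Prod>T)))\<bar>
      = \<bar>\<Sum>T\<in>Pow S. (-1) ^ card T * (real (?c T) - 2 * real H / real (\<Prod>S * \<Prod>T))\<bar>"
    by (simp only: sum_subtractf right_diff_distrib)
  also have "\<dots> \<le> (\<Sum>T\<in>Pow S. \<bar>(-1) ^ card T * (real (?c T) - 2 * real H / real (\<Prod>S * \<Prod>T))\<bar>)"
    by (rule sum_abs)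
  also have "\<dots> \<le> (\<Sum>T\<in>Pow S. 1)"
    using bound by (intro sum_mono) (simp add: abs_mult power_abs del: of_nat_mult of_nat_prod)
  also have "\<dots> = 2 ^ card S"
    using S by (simp add: card_Pow)
  finally show ?thesis unfolding eq1 eq2 .
qed

subsection \<open>Monic polynomials that are Eisenstein at given primes\<close>

text \<open>A separate set \<open>X i\<close> for each index lets the constant coefficient satisfy a
  stronger condition than the others.\<close>

lemma bij_betw_monic_polys_PiE:
  fixes X :: "nat \<Rightarrow> 'a::comm_ring_1 set"
  shows "bij_betw (\<lambda>f. restrict (coeff f) {..<d})
    {f. degree f = d \<and> lead_coeff f = 1 \<and> (\<forall>i<d. coeff f i \<in> X i)} (PiE {..<d} X)"
proof -
  define h where "h = (\<lambda>g. monom (1::'a) d + (\<Sum>i<d. monom (g i) i))"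
  have coeff_h: "coeff (h g) i = (if i = d then 1 else if i < d then g i else 0)" for g i
    by (auto simp: h_def coeff_sum)
  have degree_h: "degree (h g) = d" for g
    by (rule antisym) (auto intro!: degree_le le_degree simp: coeff_h)
  show ?thesis
  proof (rule bij_betw_byWitness[where f' = h])
    show "\<forall>f\<in>{f. degree f = d \<and> lead_coeff f = 1 \<and> (\<forall>i<d. coeff f i \<in> X i)}.
        h (restrict (coeff f) {..<d}) = f"
      by (auto simp: poly_eq_iff coeff_h coeff_eq_0)
    show "\<forall>g\<in>PiE {..<d} X. restrict (coeff (h g)) {..<d} = g"
      by (auto simp: fun_eq_iff coeff_h PiE_def extensional_def)
    show "(\<lambda>f. restrict (coeff f) {..<d}) `
        {f. degree f = d \<and> lead_coeff f = 1 \<and> (\<forall>i<d. coeff f i \<in> X i)} \<subseteq> PiE {..<d} X"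
      by (rule image_subsetI) (simp add: PiE_iff)
    show "h ` PiE {..<d} X \<subseteq>
        {f. degree f = d \<and> lead_coeff f = 1 \<and> (\<forall>i<d. coeff f i \<in> X i)}"
      by (rule image_subsetI) (simp add: PiE_iff coeff_h degree_h)
  qed
qed

lemma card_monic_polys:
  fixes X :: "nat \<Rightarrow> 'a::comm_ring_1 set"
  shows "card {f. degree f = d \<and> lead_coeff f = 1 \<and> (\<forall>i<d. coeff f i \<in> X i)} = (\<Prod>i<d. card (X i))"
  unfolding bij_betw_same_card[OF bij_betw_monic_polys_PiE] by (rule card_PiE) simp

text \<open>The condition on the leading coefficient is left out because a prime never divides the
  leading coefficient 1 of the monic polynomials counted here.\<close>

definition eisenstein_at :: "nat \<Rightarrow> int poly \<Rightarrow> bool" where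
  "eisenstein_at p f \<longleftrightarrow> (\<forall>i<degree f. int p dvd coeff f i) \<and> \<not> (int p)\<^sup>2 dvd coeff f 0"

definition monic_polys_height_le :: "nat \<Rightarrow> nat \<Rightarrow> int poly set" where
  "monic_polys_height_le d H =
     {f. degree f = d \<and> lead_coeff f = 1 \<and> (\<forall>i<d. \<bar>coeff f i\<bar> \<le> int H)}"

lemma card_monic_polys_height_le: "card (monic_polys_height_le d H) = (2 * H + 1) ^ d"
proof -
  have "card (monic_polys_height_le d H) = (\<Prod>i<d. card {-int H..int H})"
    unfolding card_monic_polys[symmetric] monic_polys_height_le_def
    by (rule arg_cong[where f = card]) (auto simp: abs_le_iff minus_le_iff)
  also have "card {-int H..int H} = 2 * H + 1" by (simp add: nat_eq_iff2)
  finally show ?thesis by simp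
qed

lemma finite_monic_polys_height_le: "finite (monic_polys_height_le d H)"
  by (rule card_ge_0_finite) (simp add: card_monic_polys_height_le)

text \<open>The constant coefficient is nonzero, since p^2 does not divide it, and it is a multiple
  of p. Hence p \<le> H, which leaves a finite set of primes for inclusion-exclusion.\<close>

lemma eisenstein_poly_iff_eisenstein_at:
  assumes "f \<in> monic_polys_height_le d H" "d \<ge> 1"
  shows "eisenstein_poly f \<longleftrightarrow> (\<exists>p\<in>{p. prime p \<and> p \<le> H}. eisenstein_at p f)"
proof
  assume "eisenstein_poly f"
  then obtain p :: int where p: "prime p" "\<forall>i<degree f. p dvd coeff f i" "\<not> p\<^sup>2 dvd coeff f 0"
    unfolding eisenstein_poly_def by blast
  have p0: "p > 0" using p prime_gt_0_int by blast
  have "p \<le> \<bar>coeff f 0\<bar>"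
    using p assms by (intro zdvd_imp_le) (auto simp: monic_polys_height_le_def)
  also have "\<dots> \<le> int H"
    using assms by (auto simp: monic_polys_height_le_def)
  finally have "nat p \<le> H" by simp
  moreover have "prime (nat p)" using p(1) prime_int_nat_transfer by blast
  moreover have "eisenstein_at (nat p) f" using p p0 by (simp add: eisenstein_at_def)
  ultimately show "\<exists>p\<in>{p. prime p \<and> p \<le> H}. eisenstein_at p f" by blast
next
  assume "\<exists>p\<in>{p. prime p \<and> p \<le> H}. eisenstein_at p f"
  then obtain p where p: "prime p" "eisenstein_at p f" by blast
  have "lead_coeff f = 1"
    using assms unfolding monic_polys_height_le_def by blast
  hence "\<not> int p dvd lead_coeff f"
    using p(1) by (simp only: zdvd1_eq) (auto dest: prime_gt_1_nat)
  moreover have "prime (int p)" using p(1) by simp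
  ultimately show "eisenstein_poly f"
    using p(2) unfolding eisenstein_poly_def eisenstein_at_def by blast
qed

text \<open>The conditions decouple into one per coefficient, so the count is a product; only the
  constant coefficient carries the condition on squares.\<close>

lemma card_eisenstein_at_all:
  assumes S: "finite S" "\<And>p. p \<in> S \<Longrightarrow> prime p" and d: "d \<ge> 1"
  shows "card {f \<in> monic_polys_height_le d H. \<forall>p\<in>S. eisenstein_at p f} =
    card {a::int. \<bar>a\<bar> \<le> int H \<and> int (\<Prod>S) dvd a \<and> (\<forall>p\<in>S. \<not> (int p)\<^sup>2 dvd a)} *
    card {a::int. \<bar>a\<bar> \<le> int H \<and> int (\<Prod>S) dvd a} ^ (d - 1)" (is "_ = card ?A * card ?B ^ _")
proof -
  define X where "X = (\<lambda>i::nat. if i = 0 then ?A else ?B)"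
  have dvd: "prod int S dvd a \<longleftrightarrow> (\<forall>p\<in>S. int p dvd a)" for a
    using prod_int_primes_dvd_iff[of S a] S by simp
  have "{f \<in> monic_polys_height_le d H. \<forall>p\<in>S. eisenstein_at p f} =
      {f. degree f = d \<and> lead_coeff f = 1 \<and> (\<forall>i<d. coeff f i \<in> X i)}"
  proof (rule Collect_cong)
    fix f
    have "(\<forall>i<d. coeff f i \<in> X i) \<longleftrightarrow>
        (\<forall>i<d. \<bar>coeff f i\<bar> \<le> int H \<and> int (\<Prod>S) dvd coeff f i) \<and>
        (\<forall>p\<in>S. \<not> (int p)\<^sup>2 dvd coeff f 0)"
    proof -
      have "coeff f i \<in> X i \<longleftrightarrow> (\<bar>coeff f i\<bar> \<le> int H \<and> int (\<Prod>S) dvd coeff f i) \<and>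
          (i = 0 \<longrightarrow> (\<forall>p\<in>S. \<not> (int p)\<^sup>2 dvd coeff f 0))" for i
        by (simp add: X_def)
      moreover have "0 < d" using d by simp
      ultimately show ?thesis by blast
    qed
    moreover have "(\<forall>p\<in>S. eisenstein_at p f) \<longleftrightarrow>
        (\<forall>i<d. int (\<Prod>S) dvd coeff f i) \<and> (\<forall>p\<in>S. \<not> (int p)\<^sup>2 dvd coeff f 0)"
      if "degree f = d"
      unfolding eisenstein_at_def of_nat_prod dvd that by blast
    ultimately show "f \<in> monic_polys_height_le d H \<and> (\<forall>p\<in>S. eisenstein_at p f) \<longleftrightarrow>
        degree f = d \<and> lead_coeff f = 1 \<and> (\<forall>i<d. coeff f i \<in> X i)"
      unfolding monic_polys_height_le_def mem_Collect_eq by meson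
  qed
  hence "card {f \<in> monic_polys_height_le d H. \<forall>p\<in>S. eisenstein_at p f} = (\<Prod>i<d. card (X i))"
    by (simp only: card_monic_polys)
  also have "{..<d} = insert 0 {1..<d}" using d by auto
  also have "(\<Prod>i\<in>insert 0 {1..<d}. card (X i)) = card ?A * (\<Prod>i\<in>{1..<d}. card ?B)"
    by (subst prod.insert) (auto simp: X_def intro!: prod.cong)
  finally show ?thesis by simp
qed

text \<open>This is the mean value bound n |a - b| M^(n-1), multiplied by \<open>M\<close> so that
  no exponent n - 1 appears and n = 0 is no exception.\<close>

lemma abs_power_diff_times_le:
  fixes a b M :: real
  assumes "0 \<le> a" "a \<le> M" "0 \<le> b" "b \<le> M"
  shows "\<bar>a ^ n - b ^ n\<bar> * M \<le> real n * \<bar>a - b\<bar> * M ^ n"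
proof (induction n)
  case (Suc n)
  have M: "M \<ge> 0" using assms by linarith
  have "a ^ Suc n - b ^ Suc n = a * (a ^ n - b ^ n) + (a - b) * b ^ n"
    by (simp add: algebra_simps)
  hence "\<bar>a ^ Suc n - b ^ Suc n\<bar> \<le> a * \<bar>a ^ n - b ^ n\<bar> + \<bar>a - b\<bar> * b ^ n"
    using abs_triangle_ineq[of "a * (a ^ n - b ^ n)" "(a - b) * b ^ n"] assms
    by (simp add: abs_mult)
  also have "\<dots> \<le> M * \<bar>a ^ n - b ^ n\<bar> + \<bar>a - b\<bar> * M ^ n"
    using assms by (intro add_mono mult_right_mono mult_left_mono power_mono) auto
  finally have "\<bar>a ^ Suc n - b ^ Suc n\<bar> * M \<le> (M * \<bar>a ^ n - b ^ n\<bar> + \<bar>a - b\<bar> * M ^ n) * M"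
    using M by (intro mult_right_mono)
  also have "\<dots> = M * (\<bar>a ^ n - b ^ n\<bar> * M) + \<bar>a - b\<bar> * M ^ Suc n"
    by (simp add: algebra_simps)
  also have "\<dots> \<le> M * (real n * \<bar>a - b\<bar> * M ^ n) + \<bar>a - b\<bar> * M ^ Suc n"
    using M Suc.IH by (intro add_right_mono mult_left_mono)
  also have "\<dots> = real (Suc n) * \<bar>a - b\<bar> * M ^ Suc n"
    by (simp add: algebra_simps)
  finally show ?case .
qed simp

subsection \<open>Euler factors\<close>

text \<open>For a prime p this is the proportion of monic polynomials that are Eisenstein at p: 1/p
  for each of the d - 1 upper coefficients, times 1/p - 1/p^2 for the constant one.\<close>

definition local_density :: "nat \<Rightarrow> nat \<Rightarrow> real" where
  "local_density d p = (real p - 1) / real p ^ (d + 1)"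

lemma local_density_bounds:
  assumes "p \<ge> 1"
  shows "0 \<le> local_density d p" "local_density d p \<le> 1 / real p ^ d" "local_density d p \<le> 1"
proof -
  show "0 \<le> local_density d p" using assms by (simp add: local_density_def)
  have "local_density d p \<le> real p / real p ^ (d + 1)"
    unfolding local_density_def by (intro divide_right_mono) auto
  also have "\<dots> = 1 / real p ^ d" using assms by simp
  finally show *: "local_density d p \<le> 1 / real p ^ d" .
  have "1 / real p ^ d \<le> 1" using assms by (simp add: one_le_power)
  with * show "local_density d p \<le> 1" by linarith
qed

lemma prod_local_density:
  assumes "\<And>p. p \<in> S \<Longrightarrow> prime p"
  shows "(\<Prod>p\<in>S. local_density d p) = (\<Prod>p\<in>S. 1 - 1 / real p) / real (\<Prod>S) ^ d"
proof -
  have "(\<Prod>p\<in>S. local_density d p) = (\<Prod>p\<in>S. (1 - 1 / real p) / real p ^ d)"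
  proof (rule prod.cong)
    fix p assume "p \<in> S"
    hence "real p > 0" using assms prime_gt_0_nat by simp
    thus "local_density d p = (1 - 1 / real p) / real p ^ d"
      by (simp add: local_density_def field_simps)
  qed simp
  thus ?thesis by (simp add: prod_dividef prod_power_distrib)
qed

lemma prod_one_minus_inverse_primes_bounds:
  fixes S :: "nat set"
  assumes "\<And>p. p \<in> S \<Longrightarrow> prime p"
  shows "(\<Prod>p\<in>S. 1 - 1 / real p) \<in> {0..1}"
proof -
  have "0 \<le> 1 - 1 / real p \<and> 1 - 1 / real p \<le> 1" if "p \<in> S" for p
    using assms[OF that] prime_gt_1_nat[of p] by simp
  thus ?thesis by (auto intro!: prod_nonneg prod_le_1)
qed

text \<open>With x = H/s the constant coefficient has 2xu choices up to 2^card S, and each other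
  coefficient has 2x choices up to 1. The errors are propagated through the product of these d
  counts.\<close>

lemma card_eisenstein_at_all_approx:
  assumes S: "finite S" "\<And>p. p \<in> S \<Longrightarrow> prime p" and d: "d \<ge> 1" and H: "\<Prod>S \<le> H"
  shows "\<bar>real (card {f \<in> monic_polys_height_le d H. \<forall>p\<in>S. eisenstein_at p f})
      - (2 * real H) ^ d * (\<Prod>p\<in>S. local_density d p)\<bar>
    \<le> real d * 3 ^ (d - 1) * real H ^ (d - 1) * (2 ^ card S / real (\<Prod>S) ^ (d - 1))"
proof -
  define s where "s = real (\<Prod>S)"
  define e where "e = d - 1"
  define x where "x = real H / s"
  define A where "A = real (card {a::int. \<bar>a\<bar> \<le> int H \<and> int (\<Prod>S) dvd a \<and> (\<forall>p\<in>S. \<not> (int p)\<^sup>2 dvd a)})"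
  define B where "B = real (card {a::int. \<bar>a\<bar> \<le> int H \<and> int (\<Prod>S) dvd a})"
  define u where "u = (\<Prod>p\<in>S. 1 - 1 / real p)"
  have de: "d = Suc e" using d by (simp add: e_def)
  have s1: "\<Prod>S \<ge> 1" using S Prod_primes_ge_1 by blast
  have s: "s \<ge> 1" unfolding s_def using s1 of_nat_mono[OF s1, where 'a = real] by simp
  have "s \<le> real H" unfolding s_def using of_nat_mono[OF H, where 'a = real] by simp
  hence x: "x \<ge> 1" using s by (simp add: x_def)
  have u: "0 \<le> u" "u \<le> 1"
    using prod_one_minus_inverse_primes_bounds[of S] S by (auto simp: u_def)
  have A: "\<bar>A - 2 * x * u\<bar> \<le> 2 ^ card S"
    using card_multiples_not_square_approx[of S H] S
    by (simp add: A_def x_def s_def u_def)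
  have B: "\<bar>B - 2 * x\<bar> \<le> 1"
    using card_multiples_symmetric_interval_approx[OF s1, of H]
    by (simp add: B_def x_def s_def)
  \<comment> \<open>Here x \<ge> 1, that is \<Prod>S \<le> H, gives 2x + 1 \<le> 3x; this is the
    origin of 3^(d-1).\<close>
  have B_bounds: "0 \<le> B" "B \<le> 3 * x"
    using B x by (auto simp: B_def)
  have eq1: "real (card {f \<in> monic_polys_height_le d H. \<forall>p\<in>S. eisenstein_at p f}) = A * B ^ e"
    using card_eisenstein_at_all[of S d H] S d by (simp add: A_def B_def e_def del: of_nat_prod)
  have eq2: "(2 * real H) ^ d * (\<Prod>p\<in>S. local_density d p) = 2 * x * u * (2 * x) ^ e"
  proof -
    have "(\<Prod>p\<in>S. local_density d p) = u / s ^ d"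
      unfolding u_def s_def using S by (intro prod_local_density)
    hence "(2 * real H) ^ d * (\<Prod>p\<in>S. local_density d p) = (2 * x) ^ d * u"
      by (simp add: x_def power_divide power_mult_distrib)
    thus ?thesis by (simp add: de)
  qed
  have "\<bar>A * B ^ e - 2 * x * u * (2 * x) ^ e\<bar>
      = \<bar>(A - 2 * x * u) * B ^ e + 2 * x * u * (B ^ e - (2 * x) ^ e)\<bar>"
    by (simp add: algebra_simps)
  also have "\<dots> \<le> \<bar>A - 2 * x * u\<bar> * B ^ e + 2 * x * u * \<bar>B ^ e - (2 * x) ^ e\<bar>"
    using abs_triangle_ineq[of "(A - 2 * x * u) * B ^ e" "2 * x * u * (B ^ e - (2 * x) ^ e)"]
      B_bounds u x by (simp add: abs_mult)
  also have "\<dots> \<le> 2 ^ card S * (3 * x) ^ e + real e * (3 * x) ^ e"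
  proof (rule add_mono)
    show "\<bar>A - 2 * x * u\<bar> * B ^ e \<le> 2 ^ card S * (3 * x) ^ e"
      using A B_bounds by (intro mult_mono power_mono) auto
    \<comment> \<open>Raising 2xu to 3x supplies the factor \<open>M\<close> of
      \<open>abs_power_diff_times_le\<close>.\<close>
    have "2 * x * u \<le> 2 * x * 1" using x u by (intro mult_left_mono) auto
    hence "2 * x * u * \<bar>B ^ e - (2 * x) ^ e\<bar> \<le> 3 * x * \<bar>B ^ e - (2 * x) ^ e\<bar>"
      using x by (intro mult_right_mono) auto
    also have "\<dots> = \<bar>B ^ e - (2 * x) ^ e\<bar> * (3 * x)"
      by simp
    also have "\<dots> \<le> real e * \<bar>B - 2 * x\<bar> * (3 * x) ^ e"
      using B_bounds x by (intro abs_power_diff_times_le) auto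
    also have "\<dots> \<le> real e * 1 * (3 * x) ^ e"
      using B x by (intro mult_right_mono mult_left_mono) auto
    finally show "2 * x * u * \<bar>B ^ e - (2 * x) ^ e\<bar> \<le> real e * (3 * x) ^ e"
      by simp
  qed
  \<comment> \<open>Since 2^card S \<ge> 1, both errors merge into one with the factor 1 + e =
    d.\<close>
  also have "\<dots> \<le> 2 ^ card S * (3 * x) ^ e + real e * 2 ^ card S * (3 * x) ^ e"
  proof -
    have "real e * 1 * (3 * x) ^ e \<le> real e * 2 ^ card S * (3 * x) ^ e"
      using x by (intro mult_right_mono mult_left_mono) auto
    thus ?thesis by simp
  qed
  also have "\<dots> = real d * 3 ^ (d - 1) * real H ^ (d - 1) * (2 ^ card S / s ^ (d - 1))"
    by (simp add: de x_def power_mult_distrib power_divide algebra_simps)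
  finally show ?thesis unfolding eq1 eq2 s_def .
qed

text \<open>The only multiple of \<Prod>S in the interval is 0, and 0 is divisible by the square of
  any prime in the nonempty set S.\<close>

lemma card_eisenstein_at_all_eq_0:
  assumes S: "finite S" "\<And>p. p \<in> S \<Longrightarrow> prime p" and d: "d \<ge> 1"
    and H: "H < \<Prod>S" and nonempty: "S \<noteq> {}"
  shows "card {f \<in> monic_polys_height_le d H. \<forall>p\<in>S. eisenstein_at p f} = 0"
proof -
  have "a = 0" if "\<bar>a\<bar> \<le> int H" "int (\<Prod>S) dvd a" for a
  proof (rule ccontr)
    assume "a \<noteq> 0"
    hence "int (\<Prod>S) \<le> \<bar>a\<bar>" using that(2) dvd_imp_le_int[of a "int (\<Prod>S)"] by simp
    with that(1) H show False by linarith
  qed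
  hence "{a::int. \<bar>a\<bar> \<le> int H \<and> int (\<Prod>S) dvd a \<and> (\<forall>p\<in>S. \<not> (int p)\<^sup>2 dvd a)} = {}"
    using nonempty by fastforce
  hence "card {a::int. \<bar>a\<bar> \<le> int H \<and> int (\<Prod>S) dvd a \<and> (\<forall>p\<in>S. \<not> (int p)\<^sup>2 dvd a)} = 0"
    by (simp only: card.empty)
  thus ?thesis using card_eisenstein_at_all[OF S d, of H] by simp
qed

text \<open>Each summand is at most 1/n^d with n = \<Prod>S. Different sets give different n > H,
  all at most \<Prod>P, so a tail of the power sum dominates.\<close>

lemma sum_prod_local_density_tail:
  fixes P :: "nat set" and H :: nat
  assumes P: "finite P" "\<And>p. p \<in> P \<Longrightarrow> prime p" and H: "H \<ge> 1" and d: "d \<ge> 2"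
  shows "(\<Sum>S\<in>{S. S \<subseteq> P \<and> H < \<Prod>S}. \<Prod>p\<in>S. local_density d p) \<le> 1 / real H ^ (d - 1)"
proof -
  let ?D = "{S. S \<subseteq> P \<and> H < \<Prod>S}"
  have prm: "prime p" if "p \<in> S" "S \<subseteq> P" for p S
    using that P by blast
  have "(\<Sum>S\<in>?D. \<Prod>p\<in>S. local_density d p) \<le> (\<Sum>S\<in>?D. 1 / real (\<Prod>S) ^ d)"
  proof (rule sum_mono)
    fix S assume "S \<in> ?D"
    hence "prime p" if "p \<in> S" for p using prm that by blast
    thus "(\<Prod>p\<in>S. local_density d p) \<le> 1 / real (\<Prod>S) ^ d"
      using prod_local_density[of S d] prod_one_minus_inverse_primes_bounds[of S]
      by (simp add: divide_right_mono prod_nonneg)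
  qed
  also have "\<dots> = (\<Sum>n\<in>(\<lambda>S. \<Prod>S) ` ?D. 1 / real n ^ d)"
  proof (subst sum.reindex)
    show "inj_on (\<lambda>S. \<Prod>S) ?D"
      by (rule inj_on_subset[OF inj_on_Prod_primes]) (use P finite_subset prm in blast)
  qed simp
  also have "\<dots> \<le> (\<Sum>n\<in>{H<..\<Prod>P}. 1 / real n ^ d)"
  proof (rule sum_mono2)
    show "(\<lambda>S. \<Prod>S) ` ?D \<subseteq> {H<..\<Prod>P}"
    proof clarify
      fix S assume S: "S \<subseteq> P" "H < \<Prod>S"
      have "\<Prod>S dvd \<Prod>P" using S P by (intro prod_dvd_prod_subset)
      moreover have "\<Prod>P > 0" using Prod_primes_ge_1[of P] P by (simp add: Suc_le_eq)
      ultimately have "\<Prod>S \<le> \<Prod>P" by (rule dvd_imp_le)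
      thus "\<Prod>S \<in> {H<..\<Prod>P}" using S by simp
    qed
  qed auto
  also have "\<dots> \<le> 1 / real H ^ (d - 1)"
    using H d by (rule sum_inverse_power_tail)
  finally show ?thesis .
qed

text \<open>If F is the product up to H and R that of the factors from H + 1 to n, then F - F R
  \<le> 1 - R, and the Weierstrass product inequality bounds 1 - R by the sum of the local
  densities. The bound does not depend on n, so it survives the limit.\<close>

lemma eisenstein_density_approx:
  fixes d H :: nat
  assumes d: "d \<ge> 2" and H: "H \<ge> 1"
  shows "\<bar>(\<Prod>p | prime p \<and> p \<le> H. 1 - local_density d p) - (1 - eisenstein_density d)\<bar>
    \<le> 1 / real H ^ (d - 1)"
proof -
  define g where "g = (\<lambda>p. if prime p then local_density d p else 0)"
  have g: "0 \<le> g p" "g p \<le> 1 / real p ^ d" "g p \<le> 1" for p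
    using local_density_bounds[of p d] prime_ge_1_nat[of p] by (auto simp: g_def)
  have f_eq: "(\<lambda>p. if prime p then 1 - (real p - 1) / real p ^ (d + 1) else 1) = (\<lambda>p. 1 - g p)"
    by (auto simp: g_def local_density_def fun_eq_iff)
  have lim: "(\<lambda>n. \<Prod>p\<le>n. 1 - g p) \<longlonglongrightarrow> 1 - eisenstein_density d"
    using convergent_prod_LIMSEQ[OF convergent_prod_eisenstein_density[OF d]]
    unfolding eisenstein_density_def f_eq by simp
  have finite_prod: "(\<Prod>p | prime p \<and> p \<le> H. 1 - local_density d p) = (\<Prod>p\<le>H. 1 - g p)"
    by (rule prod.mono_neutral_cong_left) (auto simp: g_def)
  have bound: "\<bar>(\<Prod>p\<le>H. 1 - g p) - (\<Prod>p\<le>n. 1 - g p)\<bar> \<le> 1 / real H ^ (d - 1)" if n: "n \<ge> H" for n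
  proof -
    define F where "F = (\<Prod>p\<le>H. 1 - g p)"
    define R where "R = (\<Prod>p\<in>{H<..n}. 1 - g p)"
    have F: "0 \<le> F" "F \<le> 1" and R: "0 \<le> R" "R \<le> 1"
      using g by (auto simp: F_def R_def intro!: prod_nonneg prod_le_1)
    have "(\<Prod>p\<le>n. 1 - g p) = F * R"
      unfolding F_def R_def using n
      by (subst prod.union_disjoint[symmetric]) (auto intro!: prod.cong)
    hence "\<bar>F - (\<Prod>p\<le>n. 1 - g p)\<bar> = F * (1 - R)"
      using F R by (simp add: algebra_simps abs_of_nonneg mult_left_le)
    also have "\<dots> \<le> 1 * (1 - R)"
      using F R by (intro mult_right_mono) auto
    also have "\<dots> \<le> (\<Sum>p\<in>{H<..n}. g p)"
      using Weierstrass_prod_ineq[of "{H<..n}" g] g by (simp add: R_def)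
    also have "\<dots> \<le> (\<Sum>p\<in>{H<..n}. 1 / real p ^ d)"
      using g by (intro sum_mono) auto
    also have "\<dots> \<le> 1 / real H ^ (d - 1)"
      using H d by (rule sum_inverse_power_tail)
    finally show ?thesis unfolding F_def .
  qed
  have "(\<lambda>n. \<bar>(\<Prod>p\<le>H. 1 - g p) - (\<Prod>p\<le>n. 1 - g p)\<bar>)
      \<longlonglongrightarrow> \<bar>(\<Prod>p\<le>H. 1 - g p) - (1 - eisenstein_density d)\<bar>"
    by (intro tendsto_intros lim)
  thus ?thesis unfolding finite_prod
    by (rule LIMSEQ_le_const2) (use bound in blast)
qed

subsection \<open>The asymptotic formula\<close>

text \<open>One explicit bound covers every d \<ge> 2. Of the constant, one \<open>C\<close> comes
  from the number of all monic polynomials and one from the sets with small product; 2^(d+1) comes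
  from the sets with large product and the tail of the Euler product, each costing 2^d H.\<close>

lemma monic_eisenstein_count_approx:
  fixes d H :: nat
  assumes d: "d \<ge> 2" and H: "H \<ge> 1"
  shows "\<bar>real (monic_eisenstein_count d H) - eisenstein_density d * 2 ^ d * real H ^ d\<bar>
    \<le> (2 * (real d * 3 ^ (d - 1)) + 2 ^ (d + 1)) * (real H ^ (d - 1) * (\<Sum>n=1..H. 1 / real n ^ (d - 1))\<^sup>2)"
proof -
  define L where "L = (\<Sum>n=1..H. 1 / real n ^ (d - 1))"
  define C where "C = real d * 3 ^ (d - 1)"
  define h where "h = real H ^ (d - 1)"
  define P where "P = {p::nat. prime p \<and> p \<le> H}"
  define N where "N = (\<lambda>S. real (card {f \<in> monic_polys_height_le d H. \<forall>p\<in>S. eisenstein_at p f}))"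
  define c where "c = (\<lambda>S. \<Prod>p\<in>S. local_density d p)"
  define V where "V = (2 * real H) ^ d"
  define non where "non = real (card {f \<in> monic_polys_height_le d H. \<forall>p\<in>P. \<not> eisenstein_at p f})"
  have P: "finite P" "\<And>p. p \<in> P \<Longrightarrow> prime p"
    by (auto simp: P_def intro: finite_subset[of _ "{..H}"])
  have fin: "finite S" if "S \<subseteq> P" for S using that P finite_subset by blast
  have C0: "C \<ge> 0" by (simp add: C_def)
  have h1: "h \<ge> 1" using H by (simp add: h_def one_le_power)
  have V_h: "V = 2 ^ d * real H * h"
    using d power_Suc[of "real H" "d - 1"] by (simp add: V_def h_def power_mult_distrib mult.assoc)
  have c_nonneg: "0 \<le> c S" if "S \<subseteq> P" for S
    unfolding c_def using that P local_density_bounds(1) prime_ge_1_nat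
    by (intro prod_nonneg) blast
  \<comment> \<open>The term n = 1 gives \<open>L\<close> \<ge> 1, so errors without the factor L^2
    can be absorbed.\<close>
  have "1 \<le> (\<Sum>n\<in>{1}. 1 / real n ^ (d - 1))" by simp
  also have "\<dots> \<le> L" unfolding L_def using H by (intro sum_mono2) auto
  finally have L1: "L \<ge> 1" .
  hence "1 \<le> L\<^sup>2" by (simp add: one_le_power)
  have h_le: "h \<le> h * L\<^sup>2"
    using \<open>1 \<le> L\<^sup>2\<close> h1 by (simp add: mult_le_cancel_left1)
  have H_le: "real H \<le> h"
    unfolding h_def using H d self_le_power[of "real H" "d - 1"] by simp

  \<comment> \<open>The count and the finite Euler product become alternating sums over the same
    sets, which are then compared term by term.\<close>
  have non_eq: "non = (\<Sum>S\<in>Pow P. (-1) ^ card S * N S)"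
    unfolding non_def N_def
    by (rule card_avoiding_conv_sum[OF finite_monic_polys_height_le P(1)])
  have prod_eq: "(\<Prod>p\<in>P. 1 - local_density d p) = (\<Sum>S\<in>Pow P. (-1) ^ card S * c S)"
    using P(1) by (simp add: prod_diff_conv_sum c_def)
  have Pow_split: "Pow P = {S. S \<subseteq> P \<and> \<Prod>S \<le> H} \<union> {S. S \<subseteq> P \<and> H < \<Prod>S}"
    by auto

  have small: "\<bar>N S - V * c S\<bar> \<le> C * h * (2 ^ card S / real (\<Prod>S) ^ (d - 1))"
    if "S \<subseteq> P" "\<Prod>S \<le> H" for S
    using card_eisenstein_at_all_approx[of S d H] that P fin d
    unfolding N_def V_def c_def C_def h_def by auto
  \<comment> \<open>No polynomial is counted here, so the whole main term is error. The empty set is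
    excluded because its product 1 is at most H.\<close>
  have large: "\<bar>N S - V * c S\<bar> = V * c S" if S: "S \<subseteq> P" "H < \<Prod>S" for S
  proof -
    have "S \<noteq> {}" using S H by auto
    hence "N S = 0" unfolding N_def
      using card_eisenstein_at_all_eq_0[of S d H] S P(2) fin[OF S(1)] d by (simp add: subset_iff)
    thus ?thesis using c_nonneg[OF S(1)] by (simp add: V_def)
  qed
  have "\<bar>non - V * (\<Prod>p\<in>P. 1 - local_density d p)\<bar> = \<bar>\<Sum>S\<in>Pow P. (-1) ^ card S * (N S - V * c S)\<bar>"
    unfolding non_eq prod_eq
    by (simp add: right_diff_distrib sum_subtractf sum_distrib_left mult.left_commute)
  also have "\<dots> \<le> (\<Sum>S\<in>Pow P. \<bar>(-1) ^ card S * (N S - V * c S)\<bar>)"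
    by (rule sum_abs)
  also have "\<dots> = (\<Sum>S\<in>Pow P. \<bar>N S - V * c S\<bar>)"
    by (simp add: abs_mult power_abs)
  also have "\<dots> = (\<Sum>S\<in>{S. S \<subseteq> P \<and> \<Prod>S \<le> H}. \<bar>N S - V * c S\<bar>)
      + (\<Sum>S\<in>{S. S \<subseteq> P \<and> H < \<Prod>S}. \<bar>N S - V * c S\<bar>)"
    unfolding Pow_split using P(1) by (intro sum.union_disjoint) auto
  also have "\<dots> \<le> C * h * L\<^sup>2 + V * (1 / h)"
  proof (rule add_mono)
    have "(\<Sum>S\<in>{S. S \<subseteq> P \<and> \<Prod>S \<le> H}. \<bar>N S - V * c S\<bar>)
        \<le> (\<Sum>S\<in>{S. S \<subseteq> P \<and> \<Prod>S \<le> H}. C * h * (2 ^ card S / real (\<Prod>S) ^ (d - 1)))"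
      using small by (intro sum_mono) blast
    also have "\<dots> = C * h * (\<Sum>S\<in>{S. S \<subseteq> P \<and> \<Prod>S \<le> H}. 2 ^ card S / real (\<Prod>S) ^ (d - 1))"
      by (rule sum_distrib_left[symmetric])
    also have "\<dots> \<le> C * h * L\<^sup>2"
      unfolding L_def using C0 h1 sum_subsets_two_power_le[OF P] by (intro mult_left_mono) auto
    finally show "(\<Sum>S\<in>{S. S \<subseteq> P \<and> \<Prod>S \<le> H}. \<bar>N S - V * c S\<bar>) \<le> C * h * L\<^sup>2" .
    have "(\<Sum>S\<in>{S. S \<subseteq> P \<and> H < \<Prod>S}. \<bar>N S - V * c S\<bar>) = V * (\<Sum>S\<in>{S. S \<subseteq> P \<and> H < \<Prod>S}. c S)"
      unfolding sum_distrib_left using large by (intro sum.cong) auto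
    also have "\<dots> \<le> V * (1 / h)"
      unfolding c_def h_def using sum_prod_local_density_tail[OF P H d]
      by (intro mult_left_mono) (auto simp: V_def)
    finally show "(\<Sum>S\<in>{S. S \<subseteq> P \<and> H < \<Prod>S}. \<bar>N S - V * c S\<bar>) \<le> V * (1 / h)" .
  qed
  finally have non_approx: "\<bar>non - V * (\<Prod>p\<in>P. 1 - local_density d p)\<bar> \<le> C * h * L\<^sup>2 + V * (1 / h)" .

  have "\<bar>V * (\<Prod>p\<in>P. 1 - local_density d p) - V * (1 - eisenstein_density d)\<bar> \<le> V * (1 / h)"
  proof -
    have "V * \<bar>(\<Prod>p\<in>P. 1 - local_density d p) - (1 - eisenstein_density d)\<bar> \<le> V * (1 / h)"
      using eisenstein_density_approx[OF d H] unfolding P_def h_def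
      by (intro mult_left_mono) (auto simp: V_def)
    thus ?thesis by (simp add: V_def abs_mult flip: right_diff_distrib)
  qed
  \<comment> \<open>The empty set imposes no condition, so this compares the number of all monic
    polynomials with (2H)^d.\<close>
  moreover have "\<bar>N {} - V\<bar> \<le> C * h"
    using small[of "{}"] H by (simp add: c_def)
  moreover have "real (monic_eisenstein_count d H) = N {} - non"
  proof -
    let ?M = "monic_polys_height_le d H"
    have "monic_eisenstein_polys d H = ?M - {f \<in> ?M. \<forall>p\<in>P. \<not> eisenstein_at p f}"
    proof -
      have "monic_eisenstein_polys d H = {f \<in> ?M. eisenstein_poly f}"
        unfolding monic_eisenstein_polys_def monic_polys_height_le_def by blast
      also have "\<dots> = {f \<in> ?M. \<exists>p\<in>P. eisenstein_at p f}"
        unfolding P_def using eisenstein_poly_iff_eisenstein_at[of _ d H] d by (intro Collect_cong) auto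
      finally show ?thesis by blast
    qed
    hence "monic_eisenstein_count d H = card ?M - card {f \<in> ?M. \<forall>p\<in>P. \<not> eisenstein_at p f}"
      unfolding monic_eisenstein_count_def
      by (simp add: card_Diff_subset finite_monic_polys_height_le)
    moreover have "card {f \<in> ?M. \<forall>p\<in>P. \<not> eisenstein_at p f} \<le> card ?M"
      by (intro card_mono finite_monic_polys_height_le) auto
    ultimately show ?thesis by (simp add: N_def non_def)
  qed
  ultimately have "\<bar>real (monic_eisenstein_count d H) - eisenstein_density d * V\<bar>
      \<le> C * h + C * h * L\<^sup>2 + 2 * (V * (1 / h))"
    using non_approx unfolding right_diff_distrib mult_1_right mult.commute[of "eisenstein_density d"]
    by linarith
  also have "V * (1 / h) = 2 ^ d * real H"
    using h1 by (simp add: V_h)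
  also have "C * h + C * h * L\<^sup>2 + 2 * (2 ^ d * real H)
      \<le> C * (h * L\<^sup>2) + C * (h * L\<^sup>2) + 2 ^ (d + 1) * (h * L\<^sup>2)"
  proof -
    have "C * h \<le> C * (h * L\<^sup>2)" using C0 h_le by (intro mult_left_mono)
    moreover have "2 ^ d * real H \<le> 2 ^ d * (h * L\<^sup>2)"
      using H_le h_le by (intro mult_left_mono) auto
    moreover have "2 ^ (d + 1) * (h * L\<^sup>2) = 2 * (2 ^ d * (h * L\<^sup>2))"
      by simp
    ultimately show ?thesis unfolding mult.assoc[of C] by linarith
  qed
  also have "\<dots> = (2 * C + 2 ^ (d + 1)) * (h * L\<^sup>2)"
    by (simp add: algebra_simps)
  finally show ?thesis
    by (simp add: V_def C_def h_def L_def power_mult_distrib mult.assoc)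
qed

theorem theorem1:
  fixes d :: nat
  assumes "d \<ge> 2"
  shows "(\<lambda>H::nat. real (monic_eisenstein_count d H) - eisenstein_density d * 2 ^ d * real H ^ d)
           \<in> (if d > 2 then O(\<lambda>H. real H ^ (d - 1)) else O(\<lambda>H. real H * (ln (real H))\<^sup>2))"
proof -
  define L where "L = (\<lambda>H. \<Sum>n=1..H. 1 / real n ^ (d - 1))"
  have L0: "L H \<ge> 0" for H unfolding L_def by (intro sum_nonneg) auto
  have main: "(\<lambda>H::nat. real (monic_eisenstein_count d H) - eisenstein_density d * 2 ^ d * real H ^ d)
      \<in> O(\<lambda>H. real H ^ (d - 1) * (L H)\<^sup>2)"
  proof (rule bigoI)
    show "eventually (\<lambda>H. norm (real (monic_eisenstein_count d H) - eisenstein_density d * 2 ^ d * real H ^ d)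
        \<le> (2 * (real d * 3 ^ (d - 1)) + 2 ^ (d + 1)) * norm (real H ^ (d - 1) * (L H)\<^sup>2)) sequentially"
      using eventually_ge_at_top[of 1]
    proof eventually_elim
      case (elim H)
      thus ?case using monic_eisenstein_count_approx[OF assms elim] by (simp add: L_def)
    qed
  qed
  have "(\<lambda>H. real H ^ (d - 1) * (L H)\<^sup>2)
      \<in> (if d > 2 then O(\<lambda>H. real H ^ (d - 1)) else O(\<lambda>H. real H * (ln (real H))\<^sup>2))"
  proof (cases "d > 2")
    case True
    \<comment> \<open>The exponent d - 1 is at least 2, so the terms beyond n = 1 add up to at most
      1.\<close>
    have L2: "L H \<le> 2" if H: "H \<ge> 1" for H
    proof -
      have "{1..H} = insert 1 {1<..H}" using H by auto
      hence "L H = 1 + (\<Sum>n\<in>{1<..H}. 1 / real n ^ (d - 1))" by (simp add: L_def)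
      also have "\<dots> \<le> 1 + 1 / real 1 ^ (d - 1 - 1)"
        using True by (intro add_left_mono sum_inverse_power_tail) auto
      finally show ?thesis by simp
    qed
    have "eventually (\<lambda>H. norm (real H ^ (d - 1) * (L H)\<^sup>2) \<le> 4 * norm (real H ^ (d - 1))) sequentially"
      using eventually_ge_at_top[of 1]
    proof eventually_elim
      case (elim H)
      have "(L H)\<^sup>2 \<le> 2\<^sup>2" using L2[OF elim] L0 by (intro power_mono) auto
      hence "real H ^ (d - 1) * (L H)\<^sup>2 \<le> real H ^ (d - 1) * 4" by (intro mult_left_mono) auto
      thus ?case by (simp add: mult.commute)
    qed
    hence "(\<lambda>H. real H ^ (d - 1) * (L H)\<^sup>2) \<in> O(\<lambda>H. real H ^ (d - 1))" by (rule bigoI)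
    with True show ?thesis by simp
  next
    case False
    hence d2: "d = 2" using assms by simp
    have "eventually (\<lambda>H. norm (real H ^ (d - 1) * (L H)\<^sup>2) \<le> 4 * norm (real H * (ln (real H))\<^sup>2)) sequentially"
      \<comment> \<open>From H \<ge> 3 \<ge> e follows ln H \<ge> 1, so that 1 + ln H \<le> 2 ln
        H.\<close>
      using eventually_ge_at_top[of 3]
    proof eventually_elim
      case (elim H)
      have "1 \<le> ln (real H)"
        using elim exp_le by (subst ln_ge_iff) auto
      moreover have "L H \<le> 1 + ln (real H)"
        using harmonic_sum_le[of H] elim by (simp add: L_def d2)
      ultimately have "L H \<le> 2 * ln (real H)" by linarith
      hence "(L H)\<^sup>2 \<le> (2 * ln (real H))\<^sup>2" using L0 by (intro power_mono) auto
      hence "real H * (L H)\<^sup>2 \<le> real H * (2 * ln (real H))\<^sup>2" by (intro mult_left_mono) auto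
      thus ?case by (simp add: d2 power_mult_distrib)
    qed
    hence "(\<lambda>H. real H ^ (d - 1) * (L H)\<^sup>2) \<in> O(\<lambda>H. real H * (ln (real H))\<^sup>2)" by (rule bigoI)
    with False show ?thesis by simp
  qed
  with landau_o.big_trans[OF main] show ?thesis by (auto split: if_splits)
qed

end
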